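(* Suppose that for each graph $G=(V,E,w)$ in $\mathbb{G}_\pi$, $\tau$ is a rule that selects a unique nonempty subset $\tau(G)\subset V$. Let $R_\tau(G)$ be the isospectral reduction of $G$ onto $\tau(G)$. Then $R_\tau$ induces an equivalence relation $\sim$ on the set $\mathbb{G}_\pi$, where $G\sim H$ if $R_\tau^m(G)\simeq R_\tau^k(H)$ for some $m,k\in\mathbb{N}$.
   Context: $\mathbb{W}_\pi$ is the set of rational functions $p(\lambda)/q(\lambda)$ over $\mathbb{C}$ with $\deg p\leq\deg q$. $\mathbb{G}_\pi$ is the set of finite weighted directed graphs $G=(V,E,w)$ with $E\subset V\times V$ and $w:E\to\mathbb{W}_\pi$; $M_G=(w(i,j))_{i,j\in V}$ is the weighted adjacency matrix, with $w(i,j)=0$ if $(i,j)\notin E$. The set $\tau(G)$ is not required to be a structural set of $G$ (a nonempty vertex set meeting every non-loop cycle, with $w(i,i)\neq\lambda$ for each vertex $i$ outside it). For $G\in\mathbb{G}_\pi$ and any nonempty $S\subset V$, with $\overline S=V\setminus S$, there is a unique isospectral reduction of $G$ onto $S$ (possibly obtained by a sequence of reductions onto structural sets): it is the graph on $S$ with weighted adjacency matrix $M_{SS}-M_{S\overline S}(M_{\overline S\,\overline S}-\lambda I)^{-1}M_{\overline SS}$, where $M=M_G$ and $M_{AB}$ is the submatrix with rows in $A$ and columns in $B$. $R_\tau^m$ is the $m$-fold iterate of $R_\tau$. Two weighted directed graphs $G_1=(V_1,E_1,w_1)$, $G_2=(V_2,E_2,w_2)$ are isomorphic, $G_1\simeq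 G_2$, if there is a bijection $b:V_1\to V_2$ such that there is an edge from $i$ to $j$ in $G_1$ if and only if there is an edge from $b(i)$ to $b(j)$ in $G_2$, with the same weight.
   Formalization: The rule τ is also required to be isomorphism-invariant: if G ≃ H, some isomorphism carries τ(G) onto τ(H). For arbitrary choices of τ(G) on labelled graphs, ~ can fail to be transitive. *)

theory Defs
  imports Complex_Main "HOL-Computational_Algebra.Polynomial" "HOL-Computational_Algebra.Fraction_Field"
begin

type_synonym ratfun = "complex poly fract"

abbreviation lam :: ratfun where
  "lam \<equiv> Fract [:0, 1:] 1"

definition W_pi :: "ratfun set" where
  "W_pi = {Fract p q | p q. q \<noteq> 0 \<and> degree p \<le> degree q}"

record 'v wdigraph =
  verts :: "'v set"
  edges :: "('v \<times> 'v) set"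
  weight :: "'v \<Rightarrow> 'v \<Rightarrow> ratfun"

(* The weight function is extended by zero off the edge set, so that weight G is the weighted
   adjacency matrix of G.  An edge may carry the weight 0.  The graph without vertices is
   excluded, as it has no nonempty vertex subset to select. *)
definition G_pi :: "'v wdigraph set" where
  "G_pi = {G. finite (verts G) \<and> verts G \<noteq> {} \<and> edges G \<subseteq> verts G \<times> verts G \<and>
     (\<forall>i j. (i, j) \<in> edges G \<longrightarrow> weight G i j \<in> W_pi) \<and>
     (\<forall>i j. (i, j) \<notin> edges G \<longrightarrow> weight G i j = 0)}"

definition graph_iso :: "('v \<Rightarrow> 'v) \<Rightarrow> 'v wdigraph \<Rightarrow> 'v wdigraph \<Rightarrow> bool" where
  "graph_iso b G H \<longleftrightarrow> bij_betw b (verts G) (verts H) \<and>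
     (\<forall>i\<in>verts G. \<forall>j\<in>verts G.
        ((i, j) \<in> edges G \<longleftrightarrow> (b i, b j) \<in> edges H) \<and>
        ((i, j) \<in> edges G \<longrightarrow> weight G i j = weight H (b i) (b j)))"

definition isomorphic :: "'v wdigraph \<Rightarrow> 'v wdigraph \<Rightarrow> bool" (infix "\<simeq>" 50) where
  "G \<simeq> H \<longleftrightarrow> (\<exists>b. graph_iso b G H)"

(* The inverse of a square matrix with rows and columns indexed by the finite set T, filled up
   by zeros outside T * T; the two-sided inverse is unique once it exists. *)
definition inverse_on :: "'v set \<Rightarrow> ('v \<Rightarrow> 'v \<Rightarrow> 'a::field) \<Rightarrow> 'v \<Rightarrow> 'v \<Rightarrow> 'a" where
  "inverse_on T A = (THE B.
     (\<forall>i j. i \<notin> T \<or> j \<notin> T \<longrightarrow> B i j = 0) \<and>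
     (\<forall>i\<in>T. \<forall>j\<in>T. (\<Sum>k\<in>T. A i k * B k j) = (if i = j then 1 else 0)) \<and>
     (\<forall>i\<in>T. \<forall>j\<in>T. (\<Sum>k\<in>T. B i k * A k j) = (if i = j then 1 else 0)))"

(* For G in G_pi the matrix inverted here is always invertible: its determinant is a rational
   function of positive degree if T is nonempty, since all weights have degree at most 0. *)
definition reduced_matrix :: "'v wdigraph \<Rightarrow> 'v set \<Rightarrow> 'v \<Rightarrow> 'v \<Rightarrow> ratfun" where
  "reduced_matrix G S i j =
     (let T = verts G - S;
          M = weight G;
          N = inverse_on T (\<lambda>k l. M k l - (if k = l then lam else 0))
      in if i \<in> S \<and> j \<in> S then M i j - (\<Sum>k\<in>T. \<Sum>l\<in>T. M i k * N k l * M l j) else 0)"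

(* The edges of the graph belonging to a weighted adjacency matrix are the positions of its
   nonzero entries. *)
definition isospectral_reduction :: "'v wdigraph \<Rightarrow> 'v set \<Rightarrow> 'v wdigraph" where
  "isospectral_reduction G S =
     \<lparr>verts = S,
      edges = {(i, j). reduced_matrix G S i j \<noteq> 0},
      weight = reduced_matrix G S\<rparr>"

(* A rule must not depend on the names of the vertices: isomorphic graphs get corresponding
   vertex sets, i.e. some isomorphism maps one selected set onto the other.  (Asking this of
   every isomorphism would be a stronger condition on the rule.)  For arbitrary choice functions
   on labelled graphs the induced relation can fail to be transitive. *)
definition selection_rule :: "('v wdigraph \<Rightarrow> 'v set) \<Rightarrow> bool" where
  "selection_rule \<tau> \<longleftrightarrow>
     (\<forall>G\<in>G_pi. \<tau> G \<noteq> {} \<and> \<tau> G \<subseteq> verts G) \<and>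
     (\<forall>G\<in>G_pi. \<forall>H\<in>G_pi. G \<simeq> H \<longrightarrow> (\<exists>b. graph_iso b G H \<and> b ` \<tau> G = \<tau> H))"

definition R :: "('v wdigraph \<Rightarrow> 'v set) \<Rightarrow> 'v wdigraph \<Rightarrow> 'v wdigraph" where
  "R \<tau> G = isospectral_reduction G (\<tau> G)"

end

theory Submission
  imports Defs
begin

text \<open>
  Reflexivity and symmetry are immediate. For transitivity, suppose
  \<open>R\<^sub>\<tau>\<^sup>m G \<simeq> R\<^sub>\<tau>\<^sup>k H\<close> and
  \<open>R\<^sub>\<tau>\<^sup>r H \<simeq> R\<^sub>\<tau>\<^sup>s K\<close>. Reducing the first pair \<open>r\<close> more times and the second
  pair \<open>k\<close> more times makes both pass through the same graph \<open>R\<^sub>\<tau>\<^sup>k\<^sup>+\<^sup>r H\<close>. This works as soon as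
  \<open>R\<^sub>\<tau>\<close> maps \<open>\<bbbG>\<^sub>\<pi>\<close> to itself (\<open>R_in_G_pi\<close>) and respects isomorphism
  there (\<open>isomorphic_R\<close>).

  Both facts rest on \<open>M - \<lambda>I\<close> being invertible with an inverse over \<open>\<bbbW>\<^sub>\<pi>\<close>
  whenever \<open>M\<close> has entries in \<open>\<bbbW>\<^sub>\<pi>\<close> (\<open>ex_inverse_minus_lam\<close>). The set
  \<open>\<bbbW>\<^sub>\<pi>\<close> is a ring that contains \<open>1 / (w - \<lambda>)\<close> for each of its elements \<open>w\<close>,
  so Gaussian elimination never leaves it: every pivot has again the form \<open>w - \<lambda>\<close>, as eliminating a
  vertex only changes the matrix by elements of \<open>\<bbbW>\<^sub>\<pi>\<close>. Membership of the
  inverse in \<open>\<bbbW>\<^sub>\<pi>\<close> gives the first fact. Its existence and uniqueness allow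
  it to be carried along an isomorphism that matches the selected vertex sets, which gives the second.
\<close>


section \<open>The ring of proper rational functions\<close>

lemma Fract_in_W_pi: "q \<noteq> 0 \<Longrightarrow> degree p \<le> degree q \<Longrightarrow> Fract p q \<in> W_pi"
  unfolding W_pi_def by blast

lemma W_pi_0 [simp]: "0 \<in> W_pi"
  using Fract_in_W_pi[of 1 0] by (simp add: Zero_fract_def)

lemma W_pi_add:
  assumes "x \<in> W_pi" "y \<in> W_pi"
  shows "x + y \<in> W_pi"
proof -
  obtain p q where x: "x = Fract p q" "q \<noteq> 0" "degree p \<le> degree q"
    using assms(1) unfolding W_pi_def by blast
  obtain r s where y: "y = Fract r s" "s \<noteq> 0" "degree r \<le> degree s"
    using assms(2) unfolding W_pi_def by blast
  have "degree (p * s) \<le> degree (q * s)"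
    using x y degree_mult_le[of p s] by (simp add: degree_mult_eq)
  moreover have "degree (r * q) \<le> degree (q * s)"
    using x y degree_mult_le[of r q] by (simp add: degree_mult_eq)
  ultimately have "degree (p * s + r * q) \<le> degree (q * s)" by (rule degree_add_le)
  moreover have "x + y = Fract (p * s + r * q) (q * s)" using x y by simp
  ultimately show ?thesis using Fract_in_W_pi x(2) y(2) by (metis mult_eq_0_iff)
qed

lemma W_pi_mult:
  assumes "x \<in> W_pi" "y \<in> W_pi"
  shows "x * y \<in> W_pi"
proof -
  obtain p q where x: "x = Fract p q" "q \<noteq> 0" "degree p \<le> degree q"
    using assms(1) unfolding W_pi_def by blast
  obtain r s where y: "y = Fract r s" "s \<noteq> 0" "degree r \<le> degree s"
    using assms(2) unfolding W_pi_def by blast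
  have "degree (p * r) \<le> degree (q * s)"
    using x y degree_mult_le[of p r] by (simp add: degree_mult_eq)
  moreover have "x * y = Fract (p * r) (q * s)" using x y by simp
  ultimately show ?thesis using Fract_in_W_pi x(2) y(2) by (metis mult_eq_0_iff)
qed

lemma W_pi_uminus: "x \<in> W_pi \<Longrightarrow> - x \<in> W_pi"
  unfolding W_pi_def by (force simp: minus_fract)

lemma W_pi_diff: "x \<in> W_pi \<Longrightarrow> y \<in> W_pi \<Longrightarrow> x - y \<in> W_pi"
  using W_pi_add[of x "- y"] W_pi_uminus[of y] by simp

lemma W_pi_sum: "(\<And>k. k \<in> T \<Longrightarrow> f k \<in> W_pi) \<Longrightarrow> sum f T \<in> W_pi"
  by (induction T rule: infinite_finite_induct) (auto intro: W_pi_add)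

text \<open>In \<open>p/q - \<lambda> = (p - \<lambda>q)/q\<close> the term \<open>\<lambda>q\<close> dominates the numerator,
  whose degree is therefore \<open>degree q + 1\<close>.\<close>

lemma pivot_in_W_pi:
  assumes "w \<in> W_pi"
  shows "w - lam \<noteq> 0" "1 / (w - lam) \<in> W_pi"
proof -
  obtain p q where w: "w = Fract p q" "q \<noteq> 0" "degree p \<le> degree q"
    using assms unfolding W_pi_def by blast
  define n where "n = p - [:0, 1:] * q"
  have "degree p < degree ([:0, 1:] * q)" using w by (simp add: degree_mult_eq)
  then have deg: "degree n = Suc (degree q)"
    using w(2) degree_add_eq_right[of p "- ([:0, 1:] * q)"]
    unfolding n_def degree_minus diff_conv_add_uminus by (simp add: degree_mult_eq)
  then have n: "n \<noteq> 0" by auto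
  have eq: "w - lam = Fract n q" using w by (simp add: n_def)
  show "w - lam \<noteq> 0" unfolding eq using n w(2) by (simp add: Zero_fract_def eq_fract)
  have "1 / (w - lam) = Fract q n" unfolding eq by (simp add: divide_inverse)
  then show "1 / (w - lam) \<in> W_pi" using Fract_in_W_pi[of n q] n deg by simp
qed


section \<open>Inverses of finite matrices\<close>

definition right_inverse_on :: "'v set \<Rightarrow> ('v \<Rightarrow> 'v \<Rightarrow> 'a::field) \<Rightarrow> ('v \<Rightarrow> 'v \<Rightarrow> 'a) \<Rightarrow> bool" where
  "right_inverse_on T A B \<longleftrightarrow>
     (\<forall>i\<in>T. \<forall>j\<in>T. (\<Sum>k\<in>T. A i k * B k j) = (if i = j then 1 else 0))"

definition is_inverse_on :: "'v set \<Rightarrow> ('v \<Rightarrow> 'v \<Rightarrow> 'a::field) \<Rightarrow> ('v \<Rightarrow> 'v \<Rightarrow> 'a) \<Rightarrow> bool" where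
  "is_inverse_on T A B \<longleftrightarrow>
     (\<forall>i j. i \<notin> T \<or> j \<notin> T \<longrightarrow> B i j = 0) \<and> right_inverse_on T A B \<and> right_inverse_on T B A"

lemma left_inverse_eq_right_inverse:
  assumes "finite T" "right_inverse_on T C A" "right_inverse_on T A B" "i \<in> T" "j \<in> T"
  shows "C i j = B i j"
proof -
  have "C i j = (\<Sum>k\<in>T. C i k * (\<Sum>l\<in>T. A k l * B l j))"
  proof -
    have "(\<Sum>k\<in>T. C i k * (\<Sum>l\<in>T. A k l * B l j)) = (\<Sum>k\<in>T. C i k * (if k = j then 1 else 0))"
      using assms(3,5) by (intro sum.cong) (auto simp: right_inverse_on_def)
    then show ?thesis using assms(1,5) by (simp add: if_distrib[of "(*) _"] cong: if_cong)
  qed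
  also have "\<dots> = (\<Sum>l\<in>T. (\<Sum>k\<in>T. C i k * A k l) * B l j)"
    unfolding sum_distrib_left sum_distrib_right mult.assoc[symmetric] by (rule sum.swap)
  also have "\<dots> = (\<Sum>l\<in>T. (if i = l then 1 else 0) * B l j)"
    using assms by (intro sum.cong) (auto simp: right_inverse_on_def)
  also have "\<dots> = B i j" using assms by (simp add: if_distrib[of "\<lambda>x. x * _"] cong: if_cong)
  finally show ?thesis .
qed

lemma inverse_on_eqI:
  assumes "finite T" "is_inverse_on T A B"
  shows "inverse_on T A = B"
proof -
  have "C = B" if "is_inverse_on T A C" for C
  proof (intro ext)
    fix i j
    show "C i j = B i j"
    proof (cases "i \<in> T \<and> j \<in> T")
      case True
      then show ?thesis
        using left_inverse_eq_right_inverse[of T C A B i j] assms that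
        by (simp add: is_inverse_on_def)
    next
      case False
      then show ?thesis using assms that unfolding is_inverse_on_def by metis
    qed
  qed
  moreover have "inverse_on T A = (THE B. is_inverse_on T A B)"
    by (simp add: inverse_on_def is_inverse_on_def right_inverse_on_def)
  ultimately show ?thesis using assms(2) by (metis the_equality)
qed

lemma right_inverse_on_reindex:
  assumes "bij_betw b T T'" "right_inverse_on T' A' B'"
    "\<And>i j. i \<in> T \<Longrightarrow> j \<in> T \<Longrightarrow> A i j = A' (b i) (b j)"
    "\<And>i j. i \<in> T \<Longrightarrow> j \<in> T \<Longrightarrow> B i j = B' (b i) (b j)"
  shows "right_inverse_on T A B"
  unfolding right_inverse_on_def
proof (intro ballI)
  fix i j assume ij: "i \<in> T" "j \<in> T"
  have "(\<Sum>k\<in>T. A i k * B k j) = (\<Sum>k\<in>T. A' (b i) (b k) * B' (b k) (b j))"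
    using assms(3,4) ij by simp
  also have "\<dots> = (\<Sum>k\<in>T'. A' (b i) k * B' k (b j))"
    by (rule sum.reindex_bij_betw[OF assms(1)])
  also have "\<dots> = (if b i = b j then 1 else 0)"
    using assms(1,2) ij bij_betwE unfolding right_inverse_on_def by fast
  also have "(b i = b j) = (i = j)"
    using assms(1) ij inj_on_eq_iff[of b T i j] by (simp add: bij_betw_def)
  finally show "(\<Sum>k\<in>T. A i k * B k j) = (if i = j then 1 else 0)" .
qed

text \<open>The inverse on \<open>T\<close> is defined by description, so it can be transported only because
  the pulled back matrix is an inverse and inverses are unique.\<close>

lemma inverse_on_reindex:
  assumes "bij_betw b T T'" "finite T" "is_inverse_on T' A' B'"
    "\<And>i j. i \<in> T \<Longrightarrow> j \<in> T \<Longrightarrow> A i j = A' (b i) (b j)"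
    "i \<in> T" "j \<in> T"
  shows "inverse_on T A i j = inverse_on T' A' (b i) (b j)"
proof -
  define B where "B i j = (if i \<in> T \<and> j \<in> T then B' (b i) (b j) else 0)" for i j
  have "is_inverse_on T A B"
    unfolding is_inverse_on_def
  proof (intro conjI)
    have inv: "right_inverse_on T' A' B'" "right_inverse_on T' B' A'"
      using assms(3) by (simp_all add: is_inverse_on_def)
    show "right_inverse_on T A B"
      by (rule right_inverse_on_reindex[OF assms(1) inv(1)]) (simp_all add: assms(4) B_def)
    show "right_inverse_on T B A"
      by (rule right_inverse_on_reindex[OF assms(1) inv(2)]) (simp_all add: assms(4) B_def)
  qed (simp add: B_def)
  then have "inverse_on T A = B" by (rule inverse_on_eqI[OF assms(2)])
  moreover have "inverse_on T' A' = B'"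
    using assms(1,2,3) bij_betw_finite inverse_on_eqI by metis
  ultimately show ?thesis using assms(5,6) by (simp add: B_def)
qed

text \<open>Block inversion. If \<open>E\<close> inverts the block of \<open>A\<close> on \<open>T\<close>, then the inverse on
  \<open>insert t T\<close> is governed by the Schur complement \<open>s\<close> at the single new index \<open>t\<close>, so only the
  scalar \<open>s\<close> has to be inverted.\<close>

lemma right_inverse_on_insert:
  fixes A E :: "'v \<Rightarrow> 'v \<Rightarrow> 'a::field" and t :: 'v and T :: "'v set"
  defines "u \<equiv> \<lambda>i. \<Sum>k\<in>T. E i k * A k t"
    and "v \<equiv> \<lambda>j. \<Sum>k\<in>T. A t k * E k j"
    and "s \<equiv> A t t - (\<Sum>k\<in>T. \<Sum>l\<in>T. A t k * E k l * A l t)"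
  defines "B \<equiv> \<lambda>i j. if i = t then (if j = t then 1 / s else - (1 / s * v j))
             else if j = t then - (u i * (1 / s)) else E i j + u i * (1 / s) * v j"
  assumes "finite T" "t \<notin> T" "right_inverse_on T A E" "s \<noteq> 0"
  shows "right_inverse_on (insert t T) A B"
proof -
  have sum_insert: "(\<Sum>k\<in>insert t T. A i k * B k j) = A i t * B t j + (\<Sum>k\<in>T. A i k * B k j)" for i j
    using assms(5,6) by simp
  have Btt: "B t t = 1 / s" and Btj: "j \<noteq> t \<Longrightarrow> B t j = - (1 / s * v j)" for j
    by (simp_all add: B_def)
  have col: "(\<Sum>k\<in>T. A i k * B k t) = - (\<Sum>k\<in>T. A i k * u k) * (1 / s)" for i
  proof -
    have "(\<Sum>k\<in>T. A i k * B k t) = (\<Sum>k\<in>T. A i k * - (u k * (1 / s)))"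
      using assms(6) by (intro sum.cong) (auto simp: B_def)
    then show ?thesis by (simp add: sum_distrib_right sum_negf sum_divide_distrib)
  qed
  have blk: "(\<Sum>k\<in>T. A i k * B k j) =
      (\<Sum>k\<in>T. A i k * E k j) + (\<Sum>k\<in>T. A i k * u k) * (1 / s * v j)" if "j \<noteq> t" for i j
  proof -
    have "(\<Sum>k\<in>T. A i k * B k j) = (\<Sum>k\<in>T. A i k * E k j + A i k * u k * (1 / s * v j))"
      using assms(6) that by (intro sum.cong) (auto simp: B_def algebra_simps)
    then show ?thesis unfolding sum.distrib sum_distrib_right .
  qed
  have Au_t: "(\<Sum>k\<in>T. A t k * u k) = A t t - s"
    by (simp add: u_def s_def sum_distrib_left mult.assoc)
  have Au: "(\<Sum>k\<in>T. A i k * u k) = A i t" if "i \<in> T" for i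
  proof -
    have "(\<Sum>k\<in>T. A i k * u k) = (\<Sum>l\<in>T. (\<Sum>k\<in>T. A i k * E k l) * A l t)"
      unfolding u_def sum_distrib_left sum_distrib_right mult.assoc[symmetric] by (rule sum.swap)
    also have "\<dots> = (\<Sum>l\<in>T. (if i = l then 1 else 0) * A l t)"
      using assms(7) that by (intro sum.cong) (auto simp: right_inverse_on_def)
    also have "\<dots> = A i t"
      using assms(5) that by (simp add: if_distrib[of "\<lambda>x. x * _"] cong: if_cong)
    finally show ?thesis .
  qed
  show ?thesis
    unfolding right_inverse_on_def
  proof (intro ballI)
    fix i j assume i: "i \<in> insert t T" and j: "j \<in> insert t T"
    consider "i = t" "j = t" | "i = t" "j \<in> T" | "i \<in> T" "j = t" | "i \<in> T" "j \<in> T"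
      using i j by auto
    then show "(\<Sum>k\<in>insert t T. A i k * B k j) = (if i = j then 1 else 0)"
    proof cases
      case 1
      have "A t t * (1 / s) + - (A t t - s) * (1 / s) = 1"
        using assms(8) by (simp add: field_simps)
      then show ?thesis unfolding sum_insert 1 col Au_t Btt by (simp only: refl if_True)
    next
      case 2
      then have jt: "j \<noteq> t" using assms(6) by auto
      have "A t t * - (1 / s * v j) + (v j + (A t t - s) * (1 / s * v j)) = 0"
        using assms(8) by (simp add: field_simps)
      then show ?thesis
        unfolding sum_insert 2(1) blk[OF jt] Au_t Btj[OF jt] using jt by (simp add: v_def)
    next
      case 3
      then have "i \<noteq> t" using assms(6) by auto
      then show ?thesis unfolding sum_insert 3(2) col Au[OF 3(1)] Btt by simp
    next
      case 4
      then have jt: "j \<noteq> t" using assms(6) by auto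
      show ?thesis
        unfolding sum_insert blk[OF jt] Au[OF 4(1)] Btj[OF jt]
        using 4 assms(7) by (simp add: right_inverse_on_def)
    qed
  qed
qed


section \<open>Inverting M - lam I over the proper rational functions\<close>

abbreviation minus_lam :: "('v \<Rightarrow> 'v \<Rightarrow> ratfun) \<Rightarrow> 'v \<Rightarrow> 'v \<Rightarrow> ratfun" where
  "minus_lam M \<equiv> \<lambda>k l. M k l - (if k = l then lam else 0)"

text \<open>Eliminating one index at a time: off the diagonal \<open>M - \<lambda>I\<close> agrees with \<open>M\<close>, so the Schur
  complement at a new index is \<open>w - \<lambda>\<close> with \<open>w\<close> proper, and this pivot has a proper
  inverse.\<close>

lemma ex_right_inverse_minus_lam:
  assumes "finite T" "\<And>k l. M k l \<in> W_pi"
  shows "\<exists>B. right_inverse_on T (minus_lam M) B \<and> (\<forall>i j. B i j \<in> W_pi)"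
  using assms(1)
proof (induction T rule: finite_induct)
  case empty
  show ?case by (rule exI[of _ "\<lambda>_ _. 0"]) (simp add: right_inverse_on_def)
next
  case (insert t T)
  let ?A = "minus_lam M"
  obtain E where E: "right_inverse_on T ?A E" "\<And>i j. E i j \<in> W_pi"
    using insert.IH by blast
  define u where "u = (\<lambda>i. \<Sum>k\<in>T. E i k * ?A k t)"
  define v where "v = (\<lambda>j. \<Sum>k\<in>T. ?A t k * E k j)"
  define w where "w = M t t - (\<Sum>k\<in>T. \<Sum>l\<in>T. ?A t k * E k l * ?A l t)"
  \<comment> \<open>the block inverse of \<open>right_inverse_on_insert\<close>, whose entries are sums of products
    of proper functions\<close>
  define B where "B = (\<lambda>i j. if i = t then (if j = t then 1 / (w - lam) else - (1 / (w - lam) * v j))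
    else if j = t then - (u i * (1 / (w - lam))) else E i j + u i * (1 / (w - lam)) * v j)"
  have A: "?A k t \<in> W_pi" "?A t k \<in> W_pi" if "k \<in> T" for k
    using that insert.hyps(2) assms(2) by auto
  have u: "u i \<in> W_pi" for i
    unfolding u_def by (intro W_pi_sum W_pi_mult A E)
  have v: "v j \<in> W_pi" for j
    unfolding v_def by (intro W_pi_sum W_pi_mult A E)
  have "w \<in> W_pi"
    unfolding w_def by (intro W_pi_diff W_pi_sum W_pi_mult A E assms(2))
  note pivot = pivot_in_W_pi[OF this]
  have s: "?A t t - (\<Sum>k\<in>T. \<Sum>l\<in>T. ?A t k * E k l * ?A l t) = w - lam"
    by (simp add: w_def)
  have "right_inverse_on (insert t T) ?A B"
    unfolding B_def u_def v_def
    by (rule right_inverse_on_insert[OF insert.hyps E(1), unfolded s, OF pivot(1)])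
  moreover have "B i j \<in> W_pi" for i j
    using u v E(2) pivot(2)
    by (simp add: B_def W_pi_add W_pi_mult W_pi_uminus
        del: times_divide_eq_left times_divide_eq_right)
  ultimately show ?case by blast
qed

text \<open>A left inverse is the transpose of a right inverse of the transpose, and the transpose of
  \<open>M - \<lambda>I\<close> has the same shape.\<close>

lemma ex_inverse_minus_lam:
  assumes "finite T" "\<And>k l. M k l \<in> W_pi"
  shows "\<exists>B. is_inverse_on T (minus_lam M) B \<and> (\<forall>i j. B i j \<in> W_pi)"
proof -
  let ?A = "minus_lam M"
  obtain C where C: "right_inverse_on T ?A C" "\<And>i j. C i j \<in> W_pi"
    using ex_right_inverse_minus_lam[of T M] assms by blast
  obtain D where D: "right_inverse_on T (minus_lam (\<lambda>i j. M j i)) D"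
    using ex_right_inverse_minus_lam[of T "\<lambda>i j. M j i"] assms by blast
  have left: "right_inverse_on T (\<lambda>i j. D j i) ?A"
    unfolding right_inverse_on_def
  proof (intro ballI)
    fix i j assume ij: "i \<in> T" "j \<in> T"
    have "(\<Sum>k\<in>T. D k i * ?A k j) = (\<Sum>k\<in>T. minus_lam (\<lambda>i j. M j i) j k * D k i)"
      by (intro sum.cong) auto
    then show "(\<Sum>k\<in>T. D k i * ?A k j) = (if i = j then 1 else 0)"
      using D ij by (simp add: right_inverse_on_def)
  qed
  define B where "B i j = (if i \<in> T \<and> j \<in> T then C i j else 0)" for i j
  have B: "B i j = C i j" "B i j = D j i" if "i \<in> T" "j \<in> T" for i j
    using that left_inverse_eq_right_inverse[OF assms(1) left C(1)] by (auto simp: B_def)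
  have id: "bij_betw (\<lambda>i. i) T T" by (simp add: bij_betw_def)
  have "right_inverse_on T ?A B"
    by (rule right_inverse_on_reindex[OF id C(1)]) (simp_all add: B(1))
  moreover have "right_inverse_on T B ?A"
    by (rule right_inverse_on_reindex[OF id left]) (simp_all add: B(2))
  ultimately have "is_inverse_on T ?A B"
    by (simp add: is_inverse_on_def B_def)
  moreover have "B i j \<in> W_pi" for i j using C(2) by (simp add: B_def)
  ultimately show ?thesis by blast
qed


section \<open>Isospectral reductions\<close>

lemma weight_in_W_pi: "G \<in> G_pi \<Longrightarrow> weight G i j \<in> W_pi"
  unfolding G_pi_def by (cases "(i, j) \<in> edges G") auto

lemma isospectral_reduction_in_G_pi:
  assumes "G \<in> G_pi" "S \<noteq> {}" "S \<subseteq> verts G"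
  shows "isospectral_reduction G S \<in> G_pi"
proof -
  have fin: "finite (verts G)" using assms(1) by (simp add: G_pi_def)
  then have finT: "finite (verts G - S)" by simp
  obtain B where B: "is_inverse_on (verts G - S) (minus_lam (weight G)) B" "\<And>i j. B i j \<in> W_pi"
    using ex_inverse_minus_lam[of _ "weight G", OF finT weight_in_W_pi[OF assms(1)]] by blast
  have "reduced_matrix G S i j \<in> W_pi" for i j
    unfolding reduced_matrix_def Let_def inverse_on_eqI[OF finT B(1)]
    by (auto intro!: W_pi_diff W_pi_sum W_pi_mult B(2) weight_in_W_pi[OF assms(1)])
  moreover have "i \<in> S \<and> j \<in> S" if "reduced_matrix G S i j \<noteq> 0" for i j
    using that by (auto simp: reduced_matrix_def Let_def split: if_splits)
  ultimately show ?thesis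
    using assms(2,3) finite_subset[OF assms(3) fin]
    by (auto simp: G_pi_def isospectral_reduction_def)
qed

text \<open>Off the edge set both weight functions vanish, so an isomorphism matches the full weighted
  adjacency matrices.\<close>

lemma graph_iso_weight:
  assumes "G \<in> G_pi" "H \<in> G_pi" "graph_iso b G H" "i \<in> verts G" "j \<in> verts G"
  shows "weight G i j = weight H (b i) (b j)"
  using assms unfolding G_pi_def graph_iso_def by (cases "(i, j) \<in> edges G") auto

lemma reduced_matrix_graph_iso:
  assumes "G \<in> G_pi" "H \<in> G_pi" "graph_iso b G H" "S \<subseteq> verts G" "i \<in> S" "j \<in> S"
  shows "reduced_matrix G S i j = reduced_matrix H (b ` S) (b i) (b j)"
proof -
  define T T' where "T = verts G - S" and "T' = verts H - b ` S"
  define N N' where "N = inverse_on T (minus_lam (weight G))"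
    and "N' = inverse_on T' (minus_lam (weight H))"
  have bij: "bij_betw b (verts G) (verts H)" using assms(3) by (simp add: graph_iso_def)
  then have "b ` T = T'"
    using inj_on_image_set_diff[of b "verts G" "verts G" S] assms(4)
    by (auto simp: T_def T'_def bij_betw_def)
  with bij have bT: "bij_betw b T T'"
    using bij_betw_subset[of b "verts G" "verts H" T] by (simp add: T_def)
  have finT: "finite T" and finT': "finite T'"
    using assms(1,2) by (simp_all add: G_pi_def T_def T'_def)
  have w: "weight G k l = weight H (b k) (b l)" if "k \<in> verts G" "l \<in> verts G" for k l
    by (rule graph_iso_weight[OF assms(1-3) that])
  have bk: "b k = b l \<longleftrightarrow> k = l" if "k \<in> verts G" "l \<in> verts G" for k l
    using bij that inj_on_eq_iff[of b "verts G" k l] by (simp add: bij_betw_def)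
  obtain B' where B': "is_inverse_on T' (minus_lam (weight H)) B'"
    using ex_inverse_minus_lam[of T' "weight H", OF finT' weight_in_W_pi[OF assms(2)]] by blast
  have N: "N k l = N' (b k) (b l)" if "k \<in> T" "l \<in> T" for k l
    unfolding N_def N'_def
    by (rule inverse_on_reindex[OF bT finT B' _ that]) (simp add: T_def w bk)
  have iV: "i \<in> verts G" and jV: "j \<in> verts G" using assms(4-6) by auto
  have "(\<Sum>k\<in>T. \<Sum>l\<in>T. weight G i k * N k l * weight G l j) =
      (\<Sum>k\<in>T. \<Sum>l\<in>T. weight H (b i) (b k) * N' (b k) (b l) * weight H (b l) (b j))"
    by (intro sum.cong refl) (simp add: N w[OF iV] w[OF _ jV] T_def)
  also have "\<dots> = (\<Sum>k\<in>T. \<Sum>l\<in>T'. weight H (b i) (b k) * N' (b k) l * weight H l (b j))"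
    by (intro sum.cong refl sum.reindex_bij_betw[OF bT])
  also have "\<dots> = (\<Sum>k\<in>T'. \<Sum>l\<in>T'. weight H (b i) k * N' k l * weight H l (b j))"
    by (rule sum.reindex_bij_betw[OF bT])
  finally show ?thesis
    using assms(5,6) w[OF iV jV]
    by (simp add: reduced_matrix_def Let_def N_def N'_def T_def T'_def)
qed

lemma graph_iso_isospectral_reduction:
  assumes "G \<in> G_pi" "H \<in> G_pi" "graph_iso b G H" "S \<subseteq> verts G"
  shows "graph_iso b (isospectral_reduction G S) (isospectral_reduction H (b ` S))"
proof -
  have "bij_betw b S (b ` S)"
    using assms(3,4) by (auto simp: graph_iso_def bij_betw_def intro: inj_on_subset)
  then show ?thesis
    using reduced_matrix_graph_iso[OF assms]
    by (auto simp: graph_iso_def isospectral_reduction_def)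
qed


section \<open>Isomorphism and iterated reduction\<close>

lemma isomorphic_refl: "G \<simeq> G"
  unfolding isomorphic_def graph_iso_def by (rule exI[of _ id]) simp

lemma isomorphic_sym:
  assumes "G \<simeq> H"
  shows "H \<simeq> G"
proof -
  obtain b where b: "graph_iso b G H" using assms by (auto simp: isomorphic_def)
  define c where "c = inv_into (verts G) b"
  have bij: "bij_betw b (verts G) (verts H)" using b by (simp add: graph_iso_def)
  have c: "bij_betw c (verts H) (verts G)" unfolding c_def by (rule bij_betw_inv_into[OF bij])
  have cV: "c i \<in> verts G" "b (c i) = i" if "i \<in> verts H" for i
    using that c bij by (auto simp: bij_betwE c_def bij_betw_inv_into_right)
  have "graph_iso c H G"
    unfolding graph_iso_def
  proof (intro conjI ballI)
    fix i j assume "i \<in> verts H" "j \<in> verts H"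
    then show "(i, j) \<in> edges H \<longleftrightarrow> (c i, c j) \<in> edges G"
      "(i, j) \<in> edges H \<longrightarrow> weight H i j = weight G (c i) (c j)"
      using b cV[of i] cV[of j] unfolding graph_iso_def by metis+
  qed (rule c)
  then show ?thesis by (auto simp: isomorphic_def)
qed

lemma isomorphic_trans:
  assumes "G \<simeq> H" "H \<simeq> K"
  shows "G \<simeq> K"
proof -
  obtain b c where b: "graph_iso b G H" and c: "graph_iso c H K"
    using assms by (auto simp: isomorphic_def)
  have "b i \<in> verts H" if "i \<in> verts G" for i
    using b that by (auto simp: graph_iso_def bij_betwE)
  then have "graph_iso (c \<circ> b) G K"
    using b c unfolding graph_iso_def by (auto intro: bij_betw_trans)
  then show ?thesis by (auto simp: isomorphic_def)
qed

lemma R_in_G_pi: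
  assumes "selection_rule \<tau>" "G \<in> G_pi"
  shows "R \<tau> G \<in> G_pi"
  using assms isospectral_reduction_in_G_pi[of G "\<tau> G"] by (simp add: R_def selection_rule_def)

lemma isomorphic_R:
  assumes "selection_rule \<tau>" "G \<in> G_pi" "H \<in> G_pi" "G \<simeq> H"
  shows "R \<tau> G \<simeq> R \<tau> H"
proof -
  obtain b where b: "graph_iso b G H" "b ` \<tau> G = \<tau> H"
    using assms unfolding selection_rule_def by blast
  have "\<tau> G \<subseteq> verts G" using assms by (simp add: selection_rule_def)
  from graph_iso_isospectral_reduction[OF assms(2,3) b(1) this] b(2)
  show ?thesis by (auto simp: isomorphic_def R_def)
qed

lemma funpow_R_in_G_pi:
  assumes "selection_rule \<tau>" "G \<in> G_pi"
  shows "(R \<tau> ^^ n) G \<in> G_pi"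
  by (induction n) (simp_all add: assms R_in_G_pi)

lemma isomorphic_funpow_R:
  assumes "selection_rule \<tau>" "G \<in> G_pi" "H \<in> G_pi" "G \<simeq> H"
  shows "(R \<tau> ^^ n) G \<simeq> (R \<tau> ^^ n) H"
  by (induction n) (simp_all add: assms isomorphic_R funpow_R_in_G_pi)

theorem mainTheorem10:
  fixes \<tau> :: "'v wdigraph \<Rightarrow> 'v set"
  assumes "selection_rule \<tau>"
  shows "equiv G_pi {(G, H). G \<in> G_pi \<and> H \<in> G_pi \<and> (\<exists>m k :: nat. (R \<tau> ^^ m) G \<simeq> (R \<tau> ^^ k) H)}"
proof (rule equivI)
  let ?r = "{(G, H). G \<in> G_pi \<and> H \<in> G_pi \<and> (\<exists>m k :: nat. (R \<tau> ^^ m) G \<simeq> (R \<tau> ^^ k) H)}"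
  show "?r \<subseteq> G_pi \<times> G_pi" by auto
  show "refl_on G_pi ?r" using isomorphic_refl by (auto simp: refl_on_def)
  show "sym ?r" using isomorphic_sym by (fastforce simp: sym_def)
  show "trans ?r"
  proof (rule transI, clarsimp)
    fix G H K :: "'v wdigraph" and m k r s :: nat
    assume G: "G \<in> G_pi" and H: "H \<in> G_pi" and K: "K \<in> G_pi"
      and GH: "(R \<tau> ^^ m) G \<simeq> (R \<tau> ^^ k) H" and HK: "(R \<tau> ^^ r) H \<simeq> (R \<tau> ^^ s) K"
    note in_G_pi = funpow_R_in_G_pi[OF assms]
    have "(R \<tau> ^^ (r + m)) G \<simeq> (R \<tau> ^^ (r + k)) H"
      using isomorphic_funpow_R[OF assms in_G_pi[OF G] in_G_pi[OF H] GH, of r]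
      by (simp add: funpow_add)
    moreover have "(R \<tau> ^^ (r + k)) H \<simeq> (R \<tau> ^^ (k + s)) K"
      using isomorphic_funpow_R[OF assms in_G_pi[OF H] in_G_pi[OF K] HK, of k]
      by (simp add: funpow_add add.commute[of r k])
    ultimately show "\<exists>m k. (R \<tau> ^^ m) G \<simeq> (R \<tau> ^^ k) K"
      using isomorphic_trans by blast
  qed
qed

end
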